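(* Let $\Delta\geq3$ be an integer, and let $W_\Delta$ be the wheel graph with maximum degree $\Delta$. Then $d(W_\Delta)=\max\left\{3,\left\lceil\frac{\Delta}{2}\right\rceil\right\}$.
   Context: A vertex labeling of a graph $G$ is an injective map $f:V(G)\to\mathbb{Z}$. It induces the edge labeling $f^-:E(G)\to\mathbb{Z}$, $f^-(uv)=|f(u)-f(v)|$, and $|f^-|$ denotes the number of distinct values $f^-$ takes on $E(G)$. The difference index $d(G)$ is the minimum positive integer $k$ such that there exists a vertex labeling $f$ of $G$ with $|f^-|=k$. For an integer $\Delta\geq3$, the wheel $W_\Delta$ is the graph consisting of a center vertex $v_0$, a cycle $v_1v_2\dotsb v_\Delta v_1$, and the edges $v_0v_i$ for all $1\leq i\leq\Delta$. *)

theory Defs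
  imports Complex_Main "Graph_Theory.Pair_Digraph"
begin

text \<open>
  A finite simple graph is a \<^locale>\<open>pair_graph\<close> of the library: each edge \<open>uv\<close> is present as the
  two arcs \<open>(u, v)\<close> and \<open>(v, u)\<close>.  The induced edge labeling takes the same value on both,
  so counting its values over the arcs is counting them over the undirected edges.
\<close>

definition vertex_labeling :: "'a pair_pre_digraph \<Rightarrow> ('a \<Rightarrow> int) \<Rightarrow> bool" where
  "vertex_labeling G f \<longleftrightarrow> inj_on f (pverts G)"

definition edge_label :: "('a \<Rightarrow> int) \<Rightarrow> 'a \<times> 'a \<Rightarrow> int" where
  "edge_label f e = \<bar>f (fst e) - f (snd e)\<bar>"

definition num_edge_labels :: "'a pair_pre_digraph \<Rightarrow> ('a \<Rightarrow> int) \<Rightarrow> nat" where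
  "num_edge_labels G f = card (edge_label f ` parcs G)"

text \<open>
  For a graph without edges no positive number of edge labels is attained, and the value
  is unspecified.
\<close>
definition difference_index :: "'a pair_pre_digraph \<Rightarrow> nat" where
  "difference_index G =
     (LEAST k. 0 < k \<and> (\<exists>f. vertex_labeling G f \<and> num_edge_labels G f = k))"

text \<open>The vertex \<open>v\<^sub>i\<close> is the number \<open>i\<close>, so the center is \<open>0\<close>.\<close>
definition wheel :: "nat \<Rightarrow> nat pair_pre_digraph" where
  "wheel \<Delta> =
     \<lparr> pverts = {0..\<Delta>},
       parcs = symcl ({(0, i) |i. 1 \<le> i \<and> i \<le> \<Delta>}
                      \<union> {(i, i + 1) |i. 1 \<le> i \<and> i < \<Delta>} \<union> {(\<Delta>, 1)}) \<rparr>"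

lemma pair_graph_wheel:
  assumes "3 \<le> \<Delta>"
  shows "pair_graph (wheel \<Delta>)"
proof -
  have sub: "parcs (wheel \<Delta>) \<subseteq> {0..\<Delta>} \<times> {0..\<Delta>}"
    using assms by (auto simp: wheel_def symcl_def)
  have fin: "finite (parcs (wheel \<Delta>))"
    by (rule finite_subset[OF sub]) simp
  have verts: "pverts (wheel \<Delta>) = {0..\<Delta>}"
    by (simp add: wheel_def)
  have sym: "symmetric (with_proj (wheel \<Delta>))"
    by (auto simp: symmetric_def wheel_def symcl_def intro!: symI)
  have loopfree: "fst e \<noteq> snd e" if "e \<in> parcs (wheel \<Delta>)" for e
    using that assms by (auto simp: wheel_def symcl_def)
  show ?thesis
    using sub fin sym loopfree by unfold_locales (auto simp: verts)
qed

end

theory Submission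
  imports Defs
begin

text \<open>
  Both lower bounds come from counting the labels around one vertex.  Two neighbours of a vertex
  \<open>v\<close> can carry the same edge label only if their values lie symmetrically on the two sides of
  \<open>f v\<close>.  Hence the \<open>\<Delta>\<close> spokes at the center take at least \<open>\<lceil>\<Delta>/2\<rceil>\<close> labels
  (\<open>degree_le_twice_num_edge_labels\<close>).  At the vertex of largest value all neighbours lie on the
  same side, so its edges have pairwise distinct labels; since every vertex of the wheel has degree
  at least 3, there are at least 3 labels (\<open>min_degree_le_num_edge_labels\<close>).

  For the upper bound give the center the value 0 and the rim the \<open>\<Delta>\<close> nonzero integers from
  \<open>-\<lfloor>\<Delta>/2\<rfloor>\<close> to \<open>\<lceil>\<Delta>/2\<rceil>\<close>.  The spokes then use labels between 1 and
  \<open>\<lceil>\<Delta>/2\<rceil>\<close>.  Listed in increasing order, these integers can be arranged in a cycle that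
  climbs through every second one and descends through those left out.  Neighbours on this cycle
  are at most two places apart in the list, and at most one further unit apart because 0 is
  missing, so the rim edges have labels between 1 and 3 (\<open>edge_label_wheel_labeling\<close>).
\<close>

section \<open>Counting edge labels at one vertex\<close>

lemma finite_out_neighbours:
  assumes "pair_graph G"
  shows "finite (parcs G `` {v})"
proof -
  interpret pair_graph G by fact
  show ?thesis by (rule finite_Image) (rule pair_finite_arcs)
qed

lemma finite_edge_labels:
  assumes "pair_graph G"
  shows "finite (edge_label f ` parcs G)"
proof -
  interpret pair_graph G by fact
  show ?thesis using pair_finite_arcs by simp
qed

lemma out_neighbours_subset_verts:
  assumes "pair_graph G"
  shows "parcs G `` {v} \<subseteq> pverts G"
proof -
  interpret pair_graph G by fact
  show ?thesis by (auto dest: in_arcsD2)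
qed

lemma arcs_symmetric:
  assumes "pair_graph G" and "(u, v) \<in> parcs G"
  shows "(v, u) \<in> parcs G"
proof -
  interpret pair_graph G by fact
  show ?thesis using assms(2) by (rule arcs_symmetric)
qed

text \<open>
  A neighbour of \<open>v\<close> is determined by the label of its edge together with the side of \<open>f v\<close> on
  which its value lies.
\<close>
lemma degree_le_twice_num_edge_labels:
  assumes G: "pair_graph G" and f: "vertex_labeling G f"
  shows "card (parcs G `` {v}) \<le> 2 * num_edge_labels G f"
proof -
  let ?h = "\<lambda>u. (edge_label f (v, u), f u < f v)"
  have "inj_on ?h (parcs G `` {v})"
  proof (rule inj_onI)
    fix u w assume "u \<in> parcs G `` {v}" "w \<in> parcs G `` {v}" and eq: "?h u = ?h w"
    then have "u \<in> pverts G" "w \<in> pverts G"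
      using out_neighbours_subset_verts[OF G] by blast+
    moreover have "f u = f w"
      using eq by (auto simp: edge_label_def)
    ultimately show "u = w"
      using f by (auto simp: vertex_labeling_def dest: inj_onD)
  qed
  moreover have "?h ` (parcs G `` {v}) \<subseteq> edge_label f ` parcs G \<times> UNIV"
    by auto
  ultimately have "card (parcs G `` {v}) \<le> card (edge_label f ` parcs G \<times> (UNIV :: bool set))"
    using finite_edge_labels[OF G] by (intro card_inj_on_le[of ?h]) auto
  then show ?thesis
    by (simp add: num_edge_labels_def card_cartesian_product)
qed

text \<open>
  The edges at the vertex of largest value have pairwise distinct labels, because the value of every
  neighbour there is recovered by subtracting the label.
\<close>
lemma min_degree_le_num_edge_labels:
  assumes G: "pair_graph G" and f: "vertex_labeling G f" and ne: "pverts G \<noteq> {}"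
    and deg: "\<And>v. v \<in> pverts G \<Longrightarrow> \<delta> \<le> card (parcs G `` {v})"
  shows "\<delta> \<le> num_edge_labels G f"
proof -
  interpret pair_graph G by fact
  have fin: "finite (f ` pverts G)"
    using pair_finite_verts by simp
  then obtain v where v: "v \<in> pverts G" and "f v = Max (f ` pverts G)"
    using ne Max_in[of "f ` pverts G"] by fastforce
  then have top: "f u \<le> f v" if "u \<in> pverts G" for u
    using fin that by simp
  let ?h = "\<lambda>u. edge_label f (v, u)"
  have "inj_on ?h (parcs G `` {v})"
  proof (rule inj_onI)
    fix u w assume "u \<in> parcs G `` {v}" "w \<in> parcs G `` {v}" and eq: "?h u = ?h w"
    then have uw: "u \<in> pverts G" "w \<in> pverts G"
      using out_neighbours_subset_verts[OF G] by blast+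
    then have "f u = f w"
      using eq top[of u] top[of w] by (simp add: edge_label_def)
    then show "u = w"
      using f uw by (auto simp: vertex_labeling_def dest: inj_onD)
  qed
  moreover have "?h ` (parcs G `` {v}) \<subseteq> edge_label f ` parcs G"
    by auto
  ultimately have "card (parcs G `` {v}) \<le> card (edge_label f ` parcs G)"
    using finite_edge_labels[OF G] by (intro card_inj_on_le)
  then show ?thesis
    using deg[OF v] by (simp add: num_edge_labels_def)
qed

section \<open>Degrees in the wheel\<close>

lemma center_degree_wheel: "\<Delta> \<le> card (parcs (wheel \<Delta>) `` {0})" if "3 \<le> \<Delta>"
proof -
  have "{1..\<Delta>} \<subseteq> parcs (wheel \<Delta>) `` {0}"
    by (auto simp: wheel_def symcl_def)
  from card_mono[OF finite_out_neighbours[OF pair_graph_wheel[OF that]] this]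
  show ?thesis by simp
qed

lemma wheel_min_degree:
  assumes "3 \<le> \<Delta>" and "v \<in> pverts (wheel \<Delta>)"
  shows "3 \<le> card (parcs (wheel \<Delta>) `` {v})"
proof (cases "v = 0")
  case True
  then show ?thesis using center_degree_wheel[OF assms(1)] assms(1) by simp
next
  case False
  let ?p = "if v = 1 then \<Delta> else v - 1" and ?s = "if v = \<Delta> then 1 else v + 1"
  have v: "1 \<le> v" "v \<le> \<Delta>"
    using False assms(2) by (auto simp: wheel_def)
  have "(v, ?p) \<in> parcs (wheel \<Delta>)"
  proof (cases "v = 1")
    case False
    then obtain i where "v = i + 1" "1 \<le> i" "i < \<Delta>"
      using v that[of "v - 1"] by auto
    then have "(i, v) \<in> parcs (wheel \<Delta>)"
      by (auto simp: wheel_def symcl_def)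
    then have "(v, i) \<in> parcs (wheel \<Delta>)"
      by (rule arcs_symmetric[OF pair_graph_wheel[OF assms(1)]])
    then show ?thesis using False \<open>v = i + 1\<close> by simp
  qed (simp add: wheel_def symcl_def)
  moreover have "(v, ?s) \<in> parcs (wheel \<Delta>)" and "(v, 0) \<in> parcs (wheel \<Delta>)"
    using v by (auto simp: wheel_def symcl_def)
  ultimately have "{0, ?p, ?s} \<subseteq> parcs (wheel \<Delta>) `` {v}"
    by blast
  then have "card {0, ?p, ?s} \<le> card (parcs (wheel \<Delta>) `` {v})"
    using finite_out_neighbours[OF pair_graph_wheel[OF assms(1)]] by (rule card_mono[rotated])
  moreover have "0 \<noteq> ?p" "0 \<noteq> ?s" "?p \<noteq> ?s"
    using v assms(1) by (auto split: if_splits)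
  then have "card {0, ?p, ?s} = 3"
    by (simp only: card_insert_if finite.intros insert_iff empty_iff card.empty) simp
  ultimately show ?thesis by simp
qed

section \<open>An optimal labeling\<close>

text \<open>
  The place, counted from 1 in increasing order, of the value of the \<open>i\<close>-th rim vertex: the odd
  places in ascending order, then the even places in descending order.
\<close>
definition rim_place :: "nat \<Rightarrow> nat \<Rightarrow> int" where
  "rim_place \<Delta> i = (if 2 * i \<le> \<Delta> + 1 then 2 * int i - 1 else 2 * (int \<Delta> - int i + 1))"

text \<open>
  Shifting the place \<open>p\<close> by \<open>\<Delta> div 2\<close> would give some rim vertex the value 0 of the center, so
  values up to 0 move down by one.
\<close>
definition wheel_labeling :: "nat \<Rightarrow> nat \<Rightarrow> int" where
  "wheel_labeling \<Delta> i =
     (if i = 0 then 0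
      else let q = rim_place \<Delta> i - int (\<Delta> div 2) in if 0 < q then q else q - 1)"

lemma rim_place_bounds:
  assumes "1 \<le> i" "i \<le> \<Delta>"
  shows "1 \<le> rim_place \<Delta> i" "rim_place \<Delta> i \<le> int \<Delta>"
  using assms by (auto simp: rim_place_def)

lemma inj_on_rim_place: "inj_on (rim_place \<Delta>) {1..\<Delta>}"
proof (rule inj_onI)
  fix i j assume "i \<in> {1..\<Delta>}" "j \<in> {1..\<Delta>}" "rim_place \<Delta> i = rim_place \<Delta> j"
  then show "i = j"
    by (simp add: rim_place_def split: if_splits; presburger)
qed

lemma rim_place_succ: "\<bar>rim_place \<Delta> i - rim_place \<Delta> (i + 1)\<bar> \<le> 2"
  by (auto simp: rim_place_def)

lemma rim_place_last_first:
  assumes "3 \<le> \<Delta>"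
  shows "\<bar>rim_place \<Delta> \<Delta> - rim_place \<Delta> 1\<bar> \<le> 2"
  using assms by (auto simp: rim_place_def)

lemma vertex_labeling_wheel_labeling: "vertex_labeling (wheel \<Delta>) (wheel_labeling \<Delta>)"
  unfolding vertex_labeling_def
proof (rule inj_onI)
  fix i j
  assume "i \<in> pverts (wheel \<Delta>)" "j \<in> pverts (wheel \<Delta>)"
    and eq: "wheel_labeling \<Delta> i = wheel_labeling \<Delta> j"
  then have ij: "i \<le> \<Delta>" "j \<le> \<Delta>" by (auto simp: wheel_def)
  show "i = j"
  proof (cases "i = 0 \<or> j = 0")
    case True
    then show ?thesis
      using eq by (auto simp: wheel_labeling_def Let_def split: if_splits)
  next
    case False
    then have "rim_place \<Delta> i = rim_place \<Delta> j"
      using eq by (auto simp: wheel_labeling_def Let_def split: if_splits)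
    then show ?thesis
      using False ij by (intro inj_onD[OF inj_on_rim_place[of \<Delta>]]) auto
  qed
qed

lemma edge_label_wheel_labeling:
  assumes \<Delta>: "3 \<le> \<Delta>" and e: "e \<in> parcs (wheel \<Delta>)"
  shows "edge_label (wheel_labeling \<Delta>) e \<in> {1..int (max 3 ((\<Delta> + 1) div 2))}"
proof -
  interpret pair_graph "wheel \<Delta>" by (rule pair_graph_wheel[OF \<Delta>])
  let ?f = "wheel_labeling \<Delta>"
  obtain u v where uv: "e = (u, v)" by (cases e)
  have "?f u \<noteq> ?f v"
  proof
    assume "?f u = ?f v"
    moreover have "u \<in> pverts (wheel \<Delta>)" "v \<in> pverts (wheel \<Delta>)" "u \<noteq> v"
      using e uv by (auto dest: in_arcsD1 in_arcsD2 no_loops')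
    ultimately show False
      using vertex_labeling_wheel_labeling[of \<Delta>]
      by (auto simp: vertex_labeling_def dest: inj_onD)
  qed
  moreover have spoke_bound: "\<bar>?f i\<bar> \<le> int ((\<Delta> + 1) div 2)" if "1 \<le> i" "i \<le> \<Delta>" for i
    using rim_place_bounds[OF that] that by (auto simp: wheel_labeling_def Let_def)
  have center: "?f 0 = 0"
    by (simp add: wheel_labeling_def)
  have rim: "\<bar>?f i - ?f j\<bar> \<le> 3"
    if "1 \<le> i" "1 \<le> j" "\<bar>rim_place \<Delta> i - rim_place \<Delta> j\<bar> \<le> 2" for i j
    using that by (auto simp: wheel_labeling_def Let_def)
  have rim_edge: "\<bar>?f i - ?f (i + 1)\<bar> \<le> 3" if "1 \<le> i" for i
    using that rim_place_succ[of \<Delta> i] by (intro rim) auto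
  have closing_edge: "\<bar>?f \<Delta> - ?f 1\<bar> \<le> 3"
    using \<Delta> rim_place_last_first[OF \<Delta>] by (intro rim) auto
  have "\<bar>?f u - ?f v\<bar> \<le> int ((\<Delta> + 1) div 2) \<or> \<bar>?f u - ?f v\<bar> \<le> 3"
  proof -
    consider (spoke) i where "1 \<le> i" "i \<le> \<Delta>" "{u, v} = {0, i}"
      | (rim) i where "1 \<le> i" "{u, v} = {i, i + 1}"
      | (closing) "{u, v} = {\<Delta>, 1}"
      using e uv by (auto simp: wheel_def symcl_def)
    then show ?thesis
    proof cases
      case (spoke i)
      then have "\<bar>?f u - ?f v\<bar> = \<bar>?f i\<bar>"
        by (auto simp: doubleton_eq_iff center)
      then show ?thesis
        using spoke_bound[OF spoke(1,2)] by simp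
    next
      case (rim i)
      then show ?thesis
        using rim_edge[of i] by (auto simp: doubleton_eq_iff abs_minus_commute)
    next
      case closing
      then show ?thesis
        using closing_edge by (auto simp: doubleton_eq_iff abs_minus_commute)
    qed
  qed
  ultimately show ?thesis
    by (auto simp: uv edge_label_def)
qed

section \<open>The difference index\<close>

theorem theorem3p11:
  fixes \<Delta> :: nat
  assumes "3 \<le> \<Delta>"
  shows "int (difference_index (wheel \<Delta>)) = max 3 \<lceil>real \<Delta> / 2\<rceil>"
proof -
  let ?m = "max 3 ((\<Delta> + 1) div 2)"
  have G: "pair_graph (wheel \<Delta>)"
    by (rule pair_graph_wheel[OF assms])
  have lower: "?m \<le> num_edge_labels (wheel \<Delta>) f" if f: "vertex_labeling (wheel \<Delta>) f" for f
  proof -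
    have "3 \<le> num_edge_labels (wheel \<Delta>) f"
      using G f wheel_min_degree[OF assms]
      by (intro min_degree_le_num_edge_labels) (auto simp: wheel_def)
    moreover have "\<Delta> \<le> 2 * num_edge_labels (wheel \<Delta>) f"
      using center_degree_wheel[OF assms] degree_le_twice_num_edge_labels[OF G f]
      by (rule order_trans)
    ultimately show ?thesis by simp
  qed
  have "num_edge_labels (wheel \<Delta>) (wheel_labeling \<Delta>) \<le> card {1..int ?m}"
    unfolding num_edge_labels_def
    using edge_label_wheel_labeling[OF assms] by (intro card_mono) auto
  also have "\<dots> = ?m"
    by simp
  finally have "num_edge_labels (wheel \<Delta>) (wheel_labeling \<Delta>) = ?m"
    using lower[OF vertex_labeling_wheel_labeling] by (rule antisym)
  then have "difference_index (wheel \<Delta>) = ?m"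
    unfolding difference_index_def
    using lower vertex_labeling_wheel_labeling by (intro Least_equality) auto
  moreover have "\<lceil>real \<Delta> / 2\<rceil> = int ((\<Delta> + 1) div 2)"
    by (rule ceiling_unique) (cases "even \<Delta>"; auto elim!: evenE oddE)+
  ultimately show ?thesis by simp
qed

end
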